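(* For any fixed $\eta_0\in\mathbb{R}^r$ ($r\ge1$), the set $$\mathcal{S}_{\eta_0}:=\left\{\begin{pmatrix}A&\eta_0\\ \eta_0^\top&1\end{pmatrix}\in\mathrm{SPD}(r+1):A\in\mathrm{SPD}(r)\right\}$$ is a totally geodesic submanifold of $(\mathrm{SPD}(r+1),d_{\mathrm{AIRM}})$.
   Context: $\mathrm{SPD}(m)$ is the set of real symmetric positive definite $m\times m$ matrices. The affine-invariant Riemannian metric (AIRM) on $\mathrm{SPD}(m)$ is $\langle\Xi,\Omega\rangle_S=\frac12\mathrm{tr}(S^{-1}\Xi S^{-1}\Omega)$ for symmetric $\Xi,\Omega$; its unique geodesic from $S_0$ to $S_1$ is $\gamma(t)=S_0^{1/2}(S_0^{-1/2}S_1S_0^{-1/2})^tS_0^{1/2}$, $t\in[0,1]$, and its Riemannian distance is $d_{\mathrm{AIRM}}(S_0,S_1)=\frac{1}{\sqrt2}\|\log(S_0^{-1/2}S_1S_0^{-1/2})\|_F$. A submanifold $\mathcal{L}\subset\mathrm{SPD}(m)$ is called totally geodesic if for any two points $S_0,S_1\in\mathcal{L}$ the unique AIRM geodesic connecting them lies entirely within $\mathcal{L}$. *)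

theory Defs
  imports "HOL-Analysis.Analysis"
begin

definition symmetric_matrices :: "(real ^ 'n ^ 'n) set" where
  "symmetric_matrices = {S. transpose S = S}"

definition spd :: "(real ^ 'n ^ 'n) set" where
  "spd = {S. S \<in> symmetric_matrices \<and> (\<forall>x. x \<noteq> 0 \<longrightarrow> 0 < x \<bullet> (S *v x))}"

definition diag :: "('n \<Rightarrow> real) \<Rightarrow> real ^ 'n ^ 'n" where
  "diag d = (\<chi> i j. if i = j then d i else 0)"

(* Real power of a symmetric positive definite matrix, by the spectral calculus:
   S = P diag(d) P^T with P orthogonal gives S^t = P diag(d^t) P^T, and the result does not
   depend on the chosen diagonalization. *)
definition spd_powr :: "real ^ 'n ^ 'n \<Rightarrow> real \<Rightarrow> real ^ 'n ^ 'n"  (infixr "spd'_powr" 80) where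
  "S spd_powr t = (THE X. \<exists>P d. orthogonal_matrix P \<and>
     S = P ** diag d ** transpose P \<and>
     X = P ** diag (\<lambda>i. d i powr t) ** transpose P)"

(* The unique geodesic from S0 to S1 (parametrized by t in [0,1]) of the affine-invariant metric
   <X, Y>_S = 1/2 tr (S^-1 X S^-1 Y) on SPD, in closed form. *)
definition airm_geodesic :: "real ^ 'n ^ 'n \<Rightarrow> real ^ 'n ^ 'n \<Rightarrow> real \<Rightarrow> real ^ 'n ^ 'n" where
  "airm_geodesic S0 S1 t =
     S0 spd_powr (1/2) **
     ((S0 spd_powr (-1/2) ** S1 ** S0 spd_powr (-1/2)) spd_powr t) **
     S0 spd_powr (1/2)"

(* f is k times continuously differentiable on the (open) set U; the derivatives are those of the
   ambient space, so this is only meaningful for open U. *)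
primrec Ck_on :: "nat \<Rightarrow> 'a::real_normed_vector set \<Rightarrow> ('a \<Rightarrow> 'b::real_normed_vector) \<Rightarrow> bool" where
  "Ck_on 0 U f \<longleftrightarrow> continuous_on U f"
| "Ck_on (Suc k) U f \<longleftrightarrow> (\<forall>x\<in>U. f differentiable (at x)) \<and>
     (\<forall>v. Ck_on k U (\<lambda>x. frechet_derivative f (at x) v))"

definition smooth_on :: "'a::real_normed_vector set \<Rightarrow> ('a \<Rightarrow> 'b::real_normed_vector) \<Rightarrow> bool" where
  "smooth_on U f \<longleftrightarrow> (\<forall>k. Ck_on k U f)"

definition diffeomorphism ::
    "'a::real_normed_vector set \<Rightarrow> 'b::real_normed_vector set \<Rightarrow> ('a \<Rightarrow> 'b) \<Rightarrow> ('b \<Rightarrow> 'a) \<Rightarrow> bool" where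
  "diffeomorphism U V f g \<longleftrightarrow> homeomorphism U V f g \<and> smooth_on U f \<and> smooth_on V g"

(* L is an embedded smooth submanifold of M, where M is itself given as an embedded submanifold of
   a Euclidean space: around each point of L some chart of the Euclidean space flattens M to the
   linear space H and, at the same time, L to the linear subspace K of H (a slice chart of M).
   In particular dim L = dim K. For M = spd the space H can be taken to be the symmetric matrices,
   in which SPD is open. *)
definition embedded_submanifold :: "'a::euclidean_space set \<Rightarrow> 'a set \<Rightarrow> bool" where
  "embedded_submanifold L M \<longleftrightarrow> L \<subseteq> M \<and>
     (\<exists>(H::'a set) K. subspace H \<and> subspace K \<and> K \<subseteq> H \<and>
       (\<forall>p\<in>L. \<exists>U V (\<phi>::'a \<Rightarrow> 'a) \<psi>. open U \<and> open V \<and> p \<in> U \<and> diffeomorphism U V \<phi> \<psi> \<and>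
          \<phi> ` (M \<inter> U) = H \<inter> V \<and> \<phi> ` (L \<inter> U) = K \<inter> V))"

definition totally_geodesic_submanifold :: "(real ^ 'n ^ 'n) set \<Rightarrow> bool" where
  "totally_geodesic_submanifold L \<longleftrightarrow> embedded_submanifold L spd \<and>
     (\<forall>S0\<in>L. \<forall>S1\<in>L. \<forall>t\<in>{0..1}. airm_geodesic S0 S1 t \<in> L)"

(* The block matrix ((A, b), (b^T, c)) of size r+1. The index type 'r option has CARD('r) + 1
   elements; None is the last index. *)
definition bordered :: "real ^ 'r ^ 'r \<Rightarrow> real ^ 'r \<Rightarrow> real \<Rightarrow> real ^ 'r option ^ 'r option" where
  "bordered A b c = (\<chi> i j. case (i, j) of
       (Some k, Some l) \<Rightarrow> A $ k $ l
     | (Some k, None) \<Rightarrow> b $ k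
     | (None, Some l) \<Rightarrow> b $ l
     | (None, None) \<Rightarrow> c)"

definition S_eta :: "real ^ 'r \<Rightarrow> (real ^ 'r option ^ 'r option) set" where
  "S_eta \<eta>0 = {bordered A \<eta>0 1 | A. A \<in> spd \<and> bordered A \<eta>0 1 \<in> spd}"

end

theory Submission
  imports Defs
begin

text \<open>
  The prescribed last column turns the family of bordered matrices into an affine slice of the
  positive definite cone: with \<open>e\<close> the last basis vector and \<open>v = (b, 1)\<close>, it is
  \<open>{S \<in> spd. S *v e = v}\<close> (\<open>S_eta_eq_slice\<close>; positivity of the block \<open>A\<close> is inherited from
  \<open>S\<close>, and the last row follows from symmetry). Such a slice is totally geodesic for arbitrary
  vectors \<open>e\<close> and \<open>v\<close>.

  The geodesic from \<open>S0\<close> to \<open>S1\<close> is \<open>R ** (M spd_powr t) ** R\<close>, where \<open>R\<close> is the square root of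
  \<open>S0\<close> and \<open>M\<close> is \<open>S1\<close> multiplied on both sides by the inverse of \<open>R\<close>. If \<open>S0\<close> and \<open>S1\<close> agree on
  \<open>e\<close>, then \<open>M\<close> fixes \<open>R *v e\<close>. Every power of \<open>M\<close> then fixes this vector as well, since it lies
  in the eigenspace of \<open>M\<close> for the eigenvalue 1 (\<open>spd_powr_fixes_vector\<close>). Hence all points of the
  geodesic map \<open>e\<close> to \<open>R *v (R *v e) = S0 *v e\<close> (\<open>airm_geodesic_mult_vector\<close>).

  For the submanifold structure, the cone is open in the linear space of symmetric matrices, so a
  translation carrying a point of the slice to the origin is a slice chart near that point
  (\<open>embedded_submanifold_spd_slice\<close>).

  The real powers are defined through diagonalizations, so their calculus rests on two facts: every
  symmetric matrix is orthogonally diagonalizable (\<open>symmetric_orthogonally_diagonalizable\<close>), and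
  applying a function to the eigenvalues gives the same matrix for all diagonalizations
  (\<open>spectral_function_independent\<close>).
\<close>

section \<open>Spectral theorem for real symmetric matrices\<close>

lemma symmetric_inner_matrix:
  fixes S :: "real ^ 'n ^ 'n"
  assumes "S \<in> symmetric_matrices"
  shows "x \<bullet> (S *v y) = (S *v x) \<bullet> y"
proof -
  have "S *v x = x v* S"
    using assms transpose_matrix_vector[of S x] by (simp add: symmetric_matrices_def)
  then show ?thesis by (simp add: dot_lmul_matrix)
qed

text \<open>By homogeneity it is enough to maximize the quadratic form on the unit sphere of \<open>V\<close>, which is
  compact. With \<open>A = S\<close> the maximizer is an eigenvector of \<open>S\<close>; with \<open>A = - S\<close> the maximum gives
  a coercivity constant for \<open>S\<close>.\<close>

lemma rayleigh_quotient_attains_max: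
  fixes A :: "real ^ 'n ^ 'n"
  assumes V: "subspace V" and nz: "V \<noteq> {0}"
  obtains x where "x \<in> V" "norm x = 1" "\<And>y. y \<in> V \<Longrightarrow> y \<bullet> (A *v y) \<le> (x \<bullet> (A *v x)) * (y \<bullet> y)"
proof -
  let ?K = "sphere 0 1 \<inter> V"
  obtain v where v: "v \<in> V" "v \<noteq> 0" using nz subspace_0[OF V] by auto
  have unit: "(1 / norm y) *\<^sub>R y \<in> ?K" if "y \<in> V" "y \<noteq> 0" for y
    using that V by (simp add: subspace_scale)
  have "compact ?K" using closed_subspace[OF V] by (simp add: compact_Int_closed)
  moreover have "?K \<noteq> {}" using unit[OF v] by blast
  moreover have "continuous_on ?K (\<lambda>y. y \<bullet> (A *v y))"
    by (intro continuous_intros matrix_vector_mult_linear_continuous_on)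
  ultimately obtain x where x: "x \<in> ?K" "\<And>y. y \<in> ?K \<Longrightarrow> y \<bullet> (A *v y) \<le> x \<bullet> (A *v x)"
    using continuous_attains_sup[of ?K "\<lambda>y. y \<bullet> (A *v y)"] by metis
  have "y \<bullet> (A *v y) \<le> (x \<bullet> (A *v x)) * (y \<bullet> y)" if y: "y \<in> V" for y
  proof (cases "y = 0")
    case False
    have "((1 / norm y) *\<^sub>R y) \<bullet> (A *v ((1 / norm y) *\<^sub>R y)) \<le> x \<bullet> (A *v x)"
      using x(2)[OF unit[OF y False]] .
    then have "(y \<bullet> (A *v y)) / (norm y)\<^sup>2 \<le> x \<bullet> (A *v x)"
      by (simp add: matrix_vector_mult_scaleR power2_eq_square)
    with False show ?thesis by (simp add: divide_simps power2_norm_eq_inner)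
  qed simp
  with x(1) that show thesis by auto
qed

text \<open>The first-order condition at a maximizer \<open>x\<close> of the Rayleigh quotient, tested in the direction of
  the residual \<open>r = S *v x - l *\<^sub>R x\<close>, forces \<open>r = 0\<close>. Invariance of \<open>V\<close> makes \<open>r\<close> an
  admissible direction.\<close>

lemma symmetric_eigenvector_in_invariant_subspace:
  fixes S :: "real ^ 'n ^ 'n"
  assumes S: "S \<in> symmetric_matrices" and V: "subspace V" "V \<noteq> {0}"
    and inv: "\<And>x. x \<in> V \<Longrightarrow> S *v x \<in> V"
  obtains x l where "x \<in> V" "norm x = 1" "S *v x = l *\<^sub>R x"
proof -
  obtain x where x: "x \<in> V" "norm x = 1"
    and mx: "\<And>y. y \<in> V \<Longrightarrow> y \<bullet> (S *v y) \<le> (x \<bullet> (S *v x)) * (y \<bullet> y)"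
    using rayleigh_quotient_attains_max[OF V] by metis
  define l where "l = x \<bullet> (S *v x)"
  define r where "r = S *v x - l *\<^sub>R x"
  have rV: "r \<in> V" unfolding r_def using V x inv by (simp add: subspace_diff subspace_scale)
  define c where "c = l * (r \<bullet> r) - r \<bullet> (S *v r)"
  have c: "c \<ge> 0" using mx[OF rV] by (simp add: c_def l_def)
  have xx: "x \<bullet> x = 1" using x(2) by (simp add: dot_square_norm)
  \<comment> \<open>The maximality inequality at \<open>x + t *\<^sub>R r\<close>: a term linear in \<open>t\<close> is bounded by a quadratic one.\<close>
  have le: "2 * t * (r \<bullet> r) \<le> t * t * c" for t
  proof -
    let ?y = "x + t *\<^sub>R r"
    have "?y \<in> V" using V x rV by (simp add: subspace_add subspace_scale)
    then have "?y \<bullet> (S *v ?y) \<le> l * (?y \<bullet> ?y)" using mx l_def by simp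
    moreover have "?y \<bullet> (S *v ?y) = l + 2 * t * (r \<bullet> (S *v x)) + t * t * (r \<bullet> (S *v r))"
      using symmetric_inner_matrix[OF S, of x r]
      by (simp add: l_def matrix_vector_right_distrib matrix_vector_mult_scaleR inner_add_left
          inner_add_right inner_commute algebra_simps)
    moreover have "?y \<bullet> ?y = 1 + 2 * t * (r \<bullet> x) + t * t * (r \<bullet> r)"
      using xx by (simp add: inner_add_left inner_add_right inner_commute algebra_simps)
    moreover have "r \<bullet> (S *v x) = r \<bullet> r + l * (r \<bullet> x)"
    proof -
      have "S *v x = r + l *\<^sub>R x" by (simp add: r_def)
      then show ?thesis by (simp add: inner_add_right)
    qed
    ultimately have "l + 2 * t * (r \<bullet> r + l * (r \<bullet> x)) + t * t * (r \<bullet> (S *v r))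
        \<le> l * (1 + 2 * t * (r \<bullet> x) + t * t * (r \<bullet> r))" by (simp only:)
    then show ?thesis by (simp add: c_def algebra_simps)
  qed
  have "r \<bullet> r = 0"
  proof (rule ccontr)
    assume "r \<bullet> r \<noteq> 0"
    then have p: "r \<bullet> r > 0" by (metis inner_ge_zero order_le_less)
    \<comment> \<open>Small enough for the linear term to exceed the quadratic one; the summand 1 covers \<open>c = 0\<close>.\<close>
    define t where "t = (r \<bullet> r) / (c + 1)"
    have t: "t > 0" using p c by (simp add: t_def)
    have "t * (2 * (r \<bullet> r)) \<le> t * (t * c)" using le[of t] by (simp add: algebra_simps)
    then have "2 * (r \<bullet> r) \<le> t * c" using t by simp
    also have "\<dots> \<le> r \<bullet> r" using c p by (simp add: t_def divide_simps)
    finally show False using p by simp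
  qed
  then have "S *v x = l *\<^sub>R x" by (simp add: r_def)
  with x that show thesis by blast
qed

text \<open>An orthonormal set of eigenvectors of maximal cardinality spans the space: its orthogonal complement
  is invariant under the symmetric matrix \<open>S\<close>, so if it were nonzero it would contain a further unit
  eigenvector. Working with a maximal set avoids an induction on the dimension, which is a type here.\<close>

lemma symmetric_orthonormal_eigenbasis:
  fixes S :: "real ^ 'n ^ 'n"
  assumes S: "S \<in> symmetric_matrices"
  obtains B where "pairwise orthogonal B" "\<And>b. b \<in> B \<Longrightarrow> norm b = 1"
    "\<And>b. b \<in> B \<Longrightarrow> \<exists>l. S *v b = l *\<^sub>R b" "finite B" "card B = CARD('n)"
proof -
  define Q where "Q B \<longleftrightarrow> pairwise orthogonal B \<and> (\<forall>b\<in>B. norm b = 1 \<and> (\<exists>l. S *v b = l *\<^sub>R b))"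
    for B
  have indep: "independent B" if "Q B" for B
  proof (rule pairwise_orthogonal_independent)
    show "pairwise orthogonal B" using that by (simp add: Q_def)
    have "norm b = 1" if "b \<in> B" for b using \<open>Q B\<close> that by (simp add: Q_def)
    then show "0 \<notin> B" by force
  qed
  have bound: "finite B \<and> card B \<le> CARD('n)" if "Q B" for B
    using independent_bound[OF indep[OF that]] by simp
  have "Q {}" by (simp add: Q_def)
  then obtain B where B: "Q B" and mx: "\<And>C. Q C \<Longrightarrow> card C \<le> card B"
    using ex_has_greatest_nat[of Q "{}" card "Suc (CARD('n))"] bound by (auto simp: less_Suc_eq_le)
  define V where "V = {y. \<forall>b\<in>B. b \<bullet> y = 0}"
  have V: "subspace V" by (auto simp: V_def subspace_def inner_add_right)
  have "V = {0}"
  proof (rule ccontr)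
    assume nz: "V \<noteq> {0}"
    have "S *v x \<in> V" if "x \<in> V" for x
    proof -
      have "b \<bullet> (S *v x) = 0" if "b \<in> B" for b
        using that B \<open>x \<in> V\<close> by (auto simp: symmetric_inner_matrix[OF S] Q_def V_def)
      then show ?thesis by (simp add: V_def)
    qed
    then obtain x l where x: "x \<in> V" "norm x = 1" "S *v x = l *\<^sub>R x"
      using symmetric_eigenvector_in_invariant_subspace[OF S V nz] by metis
    have "Q (insert x B)"
      using B x by (auto simp: Q_def V_def pairwise_insert orthogonal_def inner_commute)
    moreover have "x \<notin> B" using x by (auto simp: V_def)
    ultimately show False using mx[of "insert x B"] bound[OF B] by auto
  qed
  have "y \<in> span B" for y
  proof -
    obtain u w where uw: "u \<in> span B" "\<And>w'. w' \<in> span B \<Longrightarrow> orthogonal w w'" "y = u + w"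
      using orthogonal_subspace_decomp_exists[of B y] by metis
    then have "w \<in> V" by (auto simp: V_def orthogonal_def inner_commute span_base)
    with \<open>V = {0}\<close> uw show ?thesis by simp
  qed
  then have "span B = UNIV" by blast
  then have "card B = CARD('n)"
    using indep[OF B] by (metis dim_UNIV dim_eq_card_independent dim_span DIM_cart DIM_real mult.right_neutral)
  with B bound[OF B] that show thesis by (auto simp: Q_def)
qed

lemma matrix_mult_diag_component:
  "(P ** diag d) $ i $ j = P $ i $ j * d j"
  by (simp add: matrix_matrix_mult_def diag_def mult_delta_left mult_delta_right)

lemma diag_mult_matrix_component:
  "(diag d ** P) $ i $ j = d i * P $ i $ j"
  by (simp add: matrix_matrix_mult_def diag_def mult_delta_left mult_delta_right)

lemma diag_mult_vector_component:
  "(diag d *v x) $ i = d i * x $ i"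
  by (simp add: matrix_vector_mult_def diag_def mult_delta_left mult_delta_right)

theorem symmetric_orthogonally_diagonalizable:
  fixes S :: "real ^ 'n ^ 'n"
  assumes S: "S \<in> symmetric_matrices"
  obtains P d where "orthogonal_matrix P" "S = P ** diag d ** transpose P"
proof -
  obtain B where B: "pairwise orthogonal B" "\<And>b. b \<in> B \<Longrightarrow> norm b = 1"
    "\<And>b. b \<in> B \<Longrightarrow> \<exists>l. S *v b = l *\<^sub>R b" "finite B" "card B = CARD('n)"
    using symmetric_orthonormal_eigenbasis[OF S] by metis
  obtain f :: "'n \<Rightarrow> real ^ 'n" where f: "bij_betw f UNIV B"
    using B finite_same_card_bij[of "UNIV :: 'n set" B] by auto
  then have fB: "f i \<in> B" for i by (auto simp: bij_betw_def)
  then have "\<forall>i. \<exists>l. S *v f i = l *\<^sub>R f i" using B(3) by blast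
  then obtain d where d: "\<And>i. S *v f i = d i *\<^sub>R f i" 
    using choice[of "\<lambda>i l. S *v f i = l *\<^sub>R f i"] by blast
  define P :: "real ^ 'n ^ 'n" where "P = (\<chi> i j. f j $ i)"
  have col: "column j P = f j" for j by (simp add: P_def column_def vec_eq_iff)
  have "orthogonal (f i) (f j)" if "i \<noteq> j" for i j
  proof -
    have "f i \<noteq> f j" using f that by (auto simp: bij_betw_def inj_eq)
    then show ?thesis using B(1) fB by (simp add: pairwise_def)
  qed
  then have P: "orthogonal_matrix P"
    unfolding orthogonal_matrix_orthonormal_columns col using B(2) fB by simp
  have "(S ** P) $ i $ j = (P ** diag d) $ i $ j" for i j
  proof -
    have "(S ** P) $ i $ j = (S *v f j) $ i"
      by (simp add: matrix_matrix_mult_def matrix_vector_mult_def P_def)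
    then show ?thesis by (simp add: matrix_mult_diag_component d) (simp add: P_def)
  qed
  then have "S ** P = P ** diag d" by (simp add: vec_eq_iff)
  then have "S ** (P ** transpose P) = P ** diag d ** transpose P" by (simp add: matrix_mul_assoc)
  with P have "S = P ** diag d ** transpose P" by (simp add: orthogonal_matrix_def)
  with P that show thesis by blast
qed

section \<open>Real powers of positive definite matrices\<close>

text \<open>The change of basis \<open>W = transpose Q ** P\<close> intertwines the two diagonal matrices, so an entry of
  \<open>W\<close> at \<open>(i, j)\<close> vanishes unless \<open>d j = e i\<close>. Hence \<open>W\<close> also intertwines the diagonal matrices
  with entries \<open>h (d j)\<close> and \<open>h (e i)\<close>.\<close>

lemma spectral_function_independent:
  fixes P Q :: "real ^ 'n ^ 'n"
  assumes P: "orthogonal_matrix P" and Q: "orthogonal_matrix Q"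
    and eq: "P ** diag d ** transpose P = Q ** diag e ** transpose Q"
  shows "P ** diag (\<lambda>i. h (d i)) ** transpose P = Q ** diag (\<lambda>i. h (e i)) ** transpose Q"
proof -
  let ?W = "transpose Q ** P"
  have PP: "transpose P ** P = mat 1" "P ** transpose P = mat 1"
    and QQ: "transpose Q ** Q = mat 1" "Q ** transpose Q = mat 1"
    using P Q by (auto simp: orthogonal_matrix_def)
  have "transpose Q ** (P ** diag d ** transpose P) ** P
      = transpose Q ** (Q ** diag e ** transpose Q) ** P" using eq by simp
  then have "?W ** diag d ** (transpose P ** P) = (transpose Q ** Q) ** diag e ** ?W"
    by (simp only: matrix_mul_assoc)
  then have "?W ** diag d = diag e ** ?W" by (simp add: PP QQ)
  then have "?W $ i $ j * d j = e i * ?W $ i $ j" for i j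
    by (metis matrix_mult_diag_component diag_mult_matrix_component)
  then have "?W $ i $ j * h (d j) = h (e i) * ?W $ i $ j" for i j
    by (metis mult.commute mult_cancel_left)
  then have "?W ** diag (\<lambda>i. h (d i)) = diag (\<lambda>i. h (e i)) ** ?W"
    by (simp add: vec_eq_iff matrix_mult_diag_component diag_mult_matrix_component)
  then have "Q ** (?W ** diag (\<lambda>i. h (d i))) ** transpose P
      = Q ** (diag (\<lambda>i. h (e i)) ** ?W) ** transpose P" by simp
  then have "(Q ** transpose Q) ** P ** diag (\<lambda>i. h (d i)) ** transpose P
      = Q ** diag (\<lambda>i. h (e i)) ** transpose Q ** (P ** transpose P)"
    by (simp only: matrix_mul_assoc)
  then show ?thesis by (simp add: PP QQ)
qed

text \<open>The definite description defining the power denotes, and any diagonalization may be used to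
  compute it.\<close>

lemma spd_powr_eq:
  assumes "orthogonal_matrix P" "S = P ** diag d ** transpose P"
  shows "S spd_powr t = P ** diag (\<lambda>i. d i powr t) ** transpose P"
  unfolding spd_powr_def
proof (rule the_equality)
  show "\<exists>P' d'. orthogonal_matrix P' \<and> S = P' ** diag d' ** transpose P' \<and>
      P ** diag (\<lambda>i. d i powr t) ** transpose P = P' ** diag (\<lambda>i. d' i powr t) ** transpose P'"
    using assms by blast
next
  fix X
  assume "\<exists>P' d'. orthogonal_matrix P' \<and> S = P' ** diag d' ** transpose P' \<and>
      X = P' ** diag (\<lambda>i. d' i powr t) ** transpose P'"
  then show "X = P ** diag (\<lambda>i. d i powr t) ** transpose P"
    using assms spectral_function_independent[where h = "\<lambda>x. x powr t"] by metis
qed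

lemma inner_congruence:
  fixes C M :: "real ^ 'n ^ 'n"
  shows "x \<bullet> ((transpose C ** M ** C) *v x) = (C *v x) \<bullet> (M *v (C *v x))"
proof -
  have "x \<bullet> ((transpose C ** M ** C) *v x) = x \<bullet> (transpose C *v (M *v (C *v x)))"
    by (simp only: matrix_vector_mul_assoc matrix_mul_assoc)
  also have "\<dots> = (x v* transpose C) \<bullet> (M *v (C *v x))" by (simp only: dot_lmul_matrix)
  finally show ?thesis by (simp add: vector_transpose_matrix)
qed

lemma spd_congruence:
  fixes C M :: "real ^ 'n ^ 'n"
  assumes M: "M \<in> spd" and C: "\<And>x. C *v x = 0 \<Longrightarrow> x = 0"
  shows "transpose C ** M ** C \<in> spd"
proof -
  have "transpose (transpose C ** M ** C) = transpose C ** M ** C"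
    using M by (simp add: spd_def symmetric_matrices_def matrix_transpose_mul matrix_mul_assoc)
  then show ?thesis
    using M C by (auto simp: spd_def symmetric_matrices_def inner_congruence)
qed

lemma diag_spd: "(\<And>i. 0 < d i) \<Longrightarrow> diag d \<in> spd"
proof -
  assume d: "\<And>i. 0 < d i"
  have "0 < x \<bullet> (diag d *v x)" if "x \<noteq> 0" for x
  proof -
    obtain i where i: "x $ i \<noteq> 0" using \<open>x \<noteq> 0\<close> by (auto simp: vec_eq_iff)
    have "0 < (\<Sum>i\<in>UNIV. d i * (x $ i * x $ i))"
    proof (rule sum_pos2[of _ i])
      show "0 < d i * (x $ i * x $ i)" using d i by (metis mult_pos_pos not_real_square_gt_zero)
      show "0 \<le> d k * (x $ k * x $ k)" for k using d[of k] by simp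
    qed auto
    then show ?thesis by (simp add: inner_vec_def diag_mult_vector_component algebra_simps)
  qed
  then show ?thesis by (auto simp: spd_def symmetric_matrices_def transpose_def diag_def vec_eq_iff)
qed

lemma orthogonal_transpose_kernel:
  fixes P :: "real ^ 'n ^ 'n"
  assumes "orthogonal_matrix P" "transpose P *v x = 0"
  shows "x = 0"
proof -
  have "P *v (transpose P *v x) = x"
    using assms(1) by (simp only: matrix_vector_mul_assoc orthogonal_matrix_def matrix_vector_mul_lid)
  with assms(2) show ?thesis by simp
qed

text \<open>One diagonalization computes all powers at once. The eigenvalues are positive because the diagonal
  matrix is congruent to the positive definite matrix \<open>S\<close>.\<close>

lemma spd_diagonalization:
  fixes S :: "real ^ 'n ^ 'n"
  assumes S: "S \<in> spd"
  obtains P d where "orthogonal_matrix P" "\<And>i. 0 < d i"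
    "S = P ** diag d ** transpose P"
    "\<And>t. S spd_powr t = P ** diag (\<lambda>i. d i powr t) ** transpose P"
proof -
  obtain P d where P: "orthogonal_matrix P" and eq: "S = P ** diag d ** transpose P"
    using S symmetric_orthogonally_diagonalizable[of S] by (auto simp: spd_def)
  have D: "diag d \<in> spd"
  proof -
    have "transpose P ** S ** P = (transpose P ** P) ** diag d ** (transpose P ** P)"
      by (simp only: eq matrix_mul_assoc)
    then have "transpose P ** S ** P = diag d" using P by (simp add: orthogonal_matrix_def)
    moreover have "transpose P ** S ** P \<in> spd"
      using spd_congruence[OF S] orthogonal_transpose_kernel[of "transpose P"] P by force
    ultimately show ?thesis by simp
  qed
  have "0 < d i" for i
  proof -
    have "0 < axis i 1 \<bullet> (diag d *v axis i 1)"
      using D by (simp add: spd_def axis_eq_0_iff)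
    then show ?thesis by (simp add: inner_axis' diag_mult_vector_component)
  qed
  with P eq spd_powr_eq that show thesis by blast
qed

lemma spd_powr_spd:
  assumes "S \<in> spd"
  shows "S spd_powr t \<in> spd"
proof -
  obtain P d where P: "orthogonal_matrix P" and d: "\<And>i. 0 < d i"
    and pw: "\<And>t. S spd_powr t = P ** diag (\<lambda>i. d i powr t) ** transpose P"
    using spd_diagonalization[OF assms] by metis
  have "diag (\<lambda>i. d i powr t) \<in> spd" using d by (intro diag_spd) (simp add: less_le)
  then have "transpose (transpose P) ** diag (\<lambda>i. d i powr t) ** transpose P \<in> spd"
    using orthogonal_transpose_kernel[OF P] by (intro spd_congruence)
  then show ?thesis by (simp add: pw)
qed

lemma spd_powr_mult:
  assumes "S \<in> spd"
  shows "S spd_powr a ** S spd_powr b = S spd_powr (a + b)"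
proof -
  obtain P d where P: "orthogonal_matrix P"
    and pw: "\<And>t. S spd_powr t = P ** diag (\<lambda>i. d i powr t) ** transpose P"
    using spd_diagonalization[OF assms] by metis
  have "S spd_powr a ** S spd_powr b
      = P ** diag (\<lambda>i. d i powr a) ** (transpose P ** P) ** diag (\<lambda>i. d i powr b) ** transpose P"
    by (simp only: pw matrix_mul_assoc)
  also have "\<dots> = P ** (diag (\<lambda>i. d i powr a) ** diag (\<lambda>i. d i powr b)) ** transpose P"
    using P by (simp add: orthogonal_matrix_def matrix_mul_assoc)
  also have "diag (\<lambda>i. d i powr a) ** diag (\<lambda>i. d i powr b) = diag (\<lambda>i. d i powr (a + b))"
    by (simp add: vec_eq_iff matrix_mult_diag_component) (simp add: diag_def powr_add)
  finally show ?thesis by (simp add: pw)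
qed

lemma spd_powr_one:
  assumes "S \<in> spd"
  shows "S spd_powr 1 = S"
proof -
  obtain P d where "orthogonal_matrix P" and d: "\<And>i. 0 < d i"
    and S: "S = P ** diag d ** transpose P"
    and pw: "\<And>t. S spd_powr t = P ** diag (\<lambda>i. d i powr t) ** transpose P"
    using spd_diagonalization[OF assms] by metis
  have "(\<lambda>i. d i powr 1) = d" using d by (simp add: less_imp_le)
  with S pw[of 1] show ?thesis by simp
qed

lemma spd_powr_zero:
  assumes "S \<in> spd"
  shows "S spd_powr 0 = mat 1"
proof -
  obtain P d where P: "orthogonal_matrix P" and d: "\<And>i. 0 < d i"
    and pw: "\<And>t. S spd_powr t = P ** diag (\<lambda>i. d i powr t) ** transpose P"
    using spd_diagonalization[OF assms] by metis
  have "diag (\<lambda>i. d i powr 0) = mat 1"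
    using d by (simp add: vec_eq_iff diag_def mat_def less_imp_neq[symmetric])
  with P pw[of 0] show ?thesis by (simp add: orthogonal_matrix_def)
qed

text \<open>In coordinates \<open>u = transpose P *v w\<close> that diagonalize \<open>M\<close>, the equation \<open>M *v w = w\<close> says that
  \<open>u\<close> is supported on the indices whose eigenvalue is 1, and these eigenvalues do not change under
  powers.\<close>

lemma spd_powr_fixes_vector:
  assumes M: "M \<in> spd" and w: "M *v w = w"
  shows "(M spd_powr t) *v w = w"
proof -
  obtain P d where P: "orthogonal_matrix P"
    and eq: "M = P ** diag d ** transpose P"
    and pw: "\<And>t. M spd_powr t = P ** diag (\<lambda>i. d i powr t) ** transpose P"
    using spd_diagonalization[OF M] by metis
  define u where "u = transpose P *v w"
  have Pu: "P *v u = w"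
    using P by (simp only: u_def matrix_vector_mul_assoc orthogonal_matrix_def matrix_vector_mul_lid)
  have "transpose P *v (M *v w) = (transpose P ** P) *v (diag d *v u)"
    by (simp only: eq u_def matrix_vector_mul_assoc matrix_mul_assoc)
  then have "transpose P *v w = diag d *v u"
    using P w by (simp only: orthogonal_matrix_def matrix_vector_mul_lid)
  then have "diag d *v u = u" by (simp only: u_def)
  then have "d i * u $ i = u $ i" for i by (metis diag_mult_vector_component)
  then have "u $ i = 0 \<or> d i = 1" for i by (metis mult_cancel_right1)
  then have "d i powr t * u $ i = u $ i" for i by (metis mult_zero_right mult_1 powr_one_eq_one)
  then have "diag (\<lambda>i. d i powr t) *v u = u" by (simp add: vec_eq_iff diag_mult_vector_component)
  moreover have "(M spd_powr t) *v w = P *v (diag (\<lambda>i. d i powr t) *v u)"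
    by (simp only: pw u_def matrix_vector_mul_assoc matrix_mul_assoc)
  ultimately show ?thesis using Pu by simp
qed

section \<open>Geodesics preserve a prescribed image vector\<close>

lemma spd_kernel:
  assumes "S \<in> spd" "S *v x = 0"
  shows "x = 0"
  using assms by (force simp: spd_def)

lemma spd_sandwich:
  assumes "C \<in> spd" "M \<in> spd"
  shows "C ** M ** C \<in> spd"
  using spd_congruence[OF assms(2), of C] spd_kernel[OF assms(1)] assms(1)
  by (simp add: spd_def symmetric_matrices_def)

lemma airm_geodesic_spd:
  assumes "S0 \<in> spd" "S1 \<in> spd"
  shows "airm_geodesic S0 S1 t \<in> spd"
  unfolding airm_geodesic_def by (intro spd_sandwich spd_powr_spd assms)

text \<open>The middle factor \<open>?M\<close> of the geodesic fixes \<open>?w = ?R *v e\<close>, because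
  \<open>?M *v ?w = ?I *v (S1 *v e) = ?I *v (S0 *v e) = ?R *v e\<close>.
  Only the second equality uses that the endpoints agree on \<open>e\<close>.\<close>

lemma airm_geodesic_mult_vector:
  assumes S0: "S0 \<in> spd" and S1: "S1 \<in> spd" and eq: "S0 *v e = v" "S1 *v e = v"
  shows "airm_geodesic S0 S1 t *v e = v"
proof -
  let ?R = "S0 spd_powr (1/2)" and ?I = "S0 spd_powr (-1/2)"
  let ?M = "?I ** S1 ** ?I" and ?w = "?R *v e"
  have RR: "?R ** ?R = S0" using spd_powr_mult[OF S0, of "1/2" "1/2"] spd_powr_one[OF S0] by simp
  have IR: "?I ** ?R = mat 1"
    using spd_powr_mult[OF S0, of "-1/2" "1/2"] spd_powr_zero[OF S0] by simp
  have "?M *v ?w = ?I *v (S1 *v ((?I ** ?R) *v e))"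
    by (simp only: matrix_vector_mul_assoc matrix_mul_assoc)
  also have "\<dots> = ?I *v (S0 *v e)" by (simp only: IR eq matrix_vector_mul_lid)
  also have "\<dots> = (?I ** ?R) *v ?w"
    by (subst RR[symmetric]) (simp only: matrix_vector_mul_assoc matrix_mul_assoc)
  finally have "?M *v ?w = ?w" by (simp only: IR matrix_vector_mul_lid)
  then have fix_w: "(?M spd_powr t) *v ?w = ?w"
    by (intro spd_powr_fixes_vector spd_sandwich spd_powr_spd S0 S1)
  have "airm_geodesic S0 S1 t *v e = ?R *v ((?M spd_powr t) *v ?w)"
    unfolding airm_geodesic_def by (simp only: matrix_vector_mul_assoc matrix_mul_assoc)
  also have "\<dots> = (?R ** ?R) *v e" by (subst fix_w) (simp only: matrix_vector_mul_assoc)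
  finally show ?thesis by (simp add: RR eq)
qed

section \<open>Affine slices of the positive definite cone are embedded\<close>

lemma norm_matrix_vector_mult_le:
  fixes A :: "real ^ 'n ^ 'm"
  shows "norm (A *v x) \<le> norm A * norm x"
proof -
  have "norm (A *v x) = L2_set (\<lambda>i. \<bar>A $ i \<bullet> x\<bar>) UNIV"
    by (simp add: norm_vec_def[of "A *v x"] matrix_vector_mul_component)
  also have "\<dots> \<le> L2_set (\<lambda>i. norm (A $ i) * norm x) UNIV"
    by (rule L2_set_mono) (auto simp: Cauchy_Schwarz_ineq2)
  also have "\<dots> = norm A * norm x"
    by (simp add: L2_set_left_distrib norm_vec_def[of A])
  finally show ?thesis .
qed

text \<open>The quadratic form of \<open>S\<close> is at least \<open>c\<close> times the squared norm, where \<open>c > 0\<close> is its minimum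
  on the unit sphere, and a perturbation of norm less than \<open>c\<close> changes it by less than that.\<close>

lemma spd_open_in_symmetric:
  fixes S :: "real ^ 'n ^ 'n"
  assumes S: "S \<in> spd"
  obtains c where "0 < c" "ball S c \<inter> symmetric_matrices \<subseteq> spd"
proof -
  have "(UNIV :: (real ^ 'n) set) \<noteq> {0}"
    by (metis UNIV_I singletonD zero_neq_one)
  then obtain u :: "real ^ 'n" where u: "norm u = 1"
    and mx: "\<And>y. y \<bullet> ((- S) *v y) \<le> (u \<bullet> ((- S) *v u)) * (y \<bullet> y)"
    using rayleigh_quotient_attains_max[of UNIV "- S"] subspace_UNIV by (metis UNIV_I)
  define c where "c = u \<bullet> (S *v u)"
  have neg: "(- S) *v y = - (S *v y)" for y
    by (simp add: vec_eq_iff matrix_vector_mult_def sum_negf)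
  have "u \<noteq> 0" using u by auto
  then have c: "0 < c" using S by (simp add: c_def spd_def)
  have low: "c * (y \<bullet> y) \<le> y \<bullet> (S *v y)" for y using mx[of y] by (simp add: neg c_def)
  have "X \<in> spd" if X: "X \<in> ball S c" "X \<in> symmetric_matrices" for X
  proof -
    have "0 < y \<bullet> (X *v y)" if y: "y \<noteq> 0" for y
    proof -
      have "\<bar>y \<bullet> ((X - S) *v y)\<bar> \<le> norm y * norm ((X - S) *v y)" by (rule Cauchy_Schwarz_ineq2)
      also have "\<dots> \<le> norm y * (norm (X - S) * norm y)"
        by (intro mult_left_mono norm_matrix_vector_mult_le) simp
      also have "\<dots> = norm (X - S) * (y \<bullet> y)"
        by (simp add: dot_square_norm power2_eq_square)
      also have "\<dots> < c * (y \<bullet> y)"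
        using X y by (simp add: dist_norm norm_minus_commute)
      also have "\<dots> \<le> y \<bullet> (S *v y)" by (rule low)
      finally show ?thesis by (simp add: matrix_vector_mult_diff_rdistrib inner_diff_right)
    qed
    with X show ?thesis by (simp add: spd_def)
  qed
  with c that show thesis by blast
qed

lemma Ck_on_const: "Ck_on k U (\<lambda>x. c)"
  by (induction k arbitrary: c) auto

lemma smooth_on_translation: "smooth_on U (\<lambda>x. x + a)"
proof -
  have "Ck_on k U (\<lambda>x. x + a)" for k
  proof (cases k)
    case (Suc j)
    have "((\<lambda>x. x + a) has_derivative (\<lambda>h. h)) (at x)" for x
      by (auto intro!: derivative_eq_intros)
    then have "frechet_derivative (\<lambda>x. x + a) (at x) = (\<lambda>h. h)" for x
      by (metis frechet_derivative_at)
    with Suc show ?thesis by (simp add: Ck_on_const)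
  qed (auto intro!: continuous_intros)
  then show ?thesis by (simp add: smooth_on_def)
qed

lemma diffeomorphism_translation:
  "diffeomorphism U ((\<lambda>x. x + a) ` U) (\<lambda>x. x + a) (\<lambda>x. x + - a)"
proof -
  have "homeomorphism U ((\<lambda>x. x + a) ` U) (\<lambda>x. x + a) (\<lambda>x. x + - a)"
    by (auto simp: homeomorphism_def image_image intro!: continuous_intros)
  then show ?thesis
    unfolding diffeomorphism_def using smooth_on_translation by blast
qed

text \<open>Near a point \<open>p\<close> of the slice, positive definiteness is equivalent to symmetry, so only linear
  conditions remain. The translation by \<open>- p\<close> turns them into the homogeneous conditions defining
  \<open>?H\<close> and \<open>?K\<close>.\<close>

lemma embedded_submanifold_spd_slice:
  fixes e v :: "real ^ 'n"
  shows "embedded_submanifold {S \<in> spd. S *v e = v} spd"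
proof -
  let ?L = "{S \<in> spd. S *v e = v}" and ?H = "symmetric_matrices :: (real ^ 'n ^ 'n) set"
  let ?K = "{X \<in> ?H. X *v e = 0}"
  have H: "subspace ?H"
    by (auto simp: subspace_def symmetric_matrices_def transpose_def vec_eq_iff)
  have K: "subspace ?K"
    using H by (auto simp: subspace_def matrix_vector_mult_add_rdistrib scaleR_matrix_vector_assoc[symmetric])
  have chart: "\<exists>U V \<phi> \<psi>. open U \<and> open V \<and> p \<in> U \<and> diffeomorphism U V \<phi> \<psi> \<and>
      \<phi> ` (spd \<inter> U) = ?H \<inter> V \<and> \<phi> ` (?L \<inter> U) = ?K \<inter> V" if p: "p \<in> ?L" for p
  proof -
    obtain c where c: "0 < c" "ball p c \<inter> ?H \<subseteq> spd"
      using spd_open_in_symmetric p by blast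
    let ?U = "ball p c" and ?f = "\<lambda>X. X + - p"
    let ?V = "?f ` ?U"
    have "open ?V" using open_translation_subtract[of ?U p] by simp
    have spd_U: "spd \<inter> ?U = ?H \<inter> ?U" using c(2) by (auto simp: spd_def)
    have pH: "p \<in> ?H" using p by (simp add: spd_def)
    have fH: "?f X \<in> ?H \<longleftrightarrow> X \<in> ?H" for X
      using subspace_diff[OF H, of X p] subspace_add[OF H, of "X - p" p] pH by auto
    have fK: "?f X \<in> ?K \<longleftrightarrow> X \<in> ?H \<and> X *v e = v" for X
      using fH[of X] p by (simp add: matrix_vector_mult_diff_rdistrib)
    have "?f ` (spd \<inter> ?U) = ?H \<inter> ?V" unfolding spd_U using fH by auto
    moreover have "?f ` (?L \<inter> ?U) = ?K \<inter> ?V"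
    proof -
      have "?L \<inter> ?U = {X \<in> ?H. X *v e = v} \<inter> ?U" using spd_U by auto
      then show ?thesis using fK by auto
    qed
    ultimately show ?thesis
      using \<open>open ?V\<close> c(1) diffeomorphism_translation[of ?U "- p"]
      by (intro exI[of _ ?U] exI[of _ ?V] exI[of _ ?f] exI[of _ "\<lambda>x. x + - (- p)"]) simp
  qed
  show ?thesis unfolding embedded_submanifold_def
    by (intro conjI exI[of _ ?H] exI[of _ ?K] ballI H K chart) auto
qed

lemma totally_geodesic_spd_slice:
  "totally_geodesic_submanifold {S \<in> spd. S *v e = v}"
  unfolding totally_geodesic_submanifold_def
  using embedded_submanifold_spd_slice airm_geodesic_spd airm_geodesic_mult_vector by blast

section \<open>Bordered matrices as such a slice\<close>

lemma sum_UNIV_option: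
  fixes f :: "'r::finite option \<Rightarrow> 'a::comm_monoid_add"
  shows "sum f UNIV = f None + (\<Sum>k\<in>UNIV. f (Some k))"
  by (simp add: UNIV_option_conv sum.reindex)

lemma spd_principal_submatrix:
  fixes S :: "real ^ ('r::finite) option ^ 'r option"
  assumes S: "S \<in> spd"
  shows "(\<chi> k l. S $ Some k $ Some l) \<in> spd"
proof -
  let ?A = "\<chi> k l. S $ Some k $ Some l"
  have "0 < x \<bullet> (?A *v x)" if x: "x \<noteq> 0" for x
  proof -
    \<comment> \<open>Extending by zero turns the quadratic form of the block into that of \<open>S\<close>.\<close>
    let ?y = "(\<chi> i. case i of None \<Rightarrow> 0 | Some k \<Rightarrow> x $ k) :: real ^ 'r option"
    obtain k where "x $ k \<noteq> 0" using x by (auto simp: vec_eq_iff)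
    then have "?y $ Some k \<noteq> 0" by simp
    then have "?y \<noteq> 0" by (metis zero_index)
    then have "0 < ?y \<bullet> (S *v ?y)" using S by (simp add: spd_def)
    then show ?thesis by (simp add: inner_vec_def matrix_vector_mult_def sum_UNIV_option)
  qed
  then show ?thesis
    using S by (auto simp: spd_def symmetric_matrices_def transpose_def vec_eq_iff)
qed

text \<open>The last basis vector \<open>axis None 1\<close> picks out the last column. The converse inclusion recovers the
  last row by symmetry and the block \<open>A\<close> as a principal submatrix.\<close>

lemma S_eta_eq_slice:
  "S_eta b = {S \<in> spd. S *v axis None 1 = (\<chi> i. case i of None \<Rightarrow> 1 | Some k \<Rightarrow> b $ k)}"
  (is "_ = ?R")
proof (intro equalityI subsetI)
  fix S assume "S \<in> S_eta b"
  then obtain A where S: "S = bordered A b 1" "S \<in> spd" by (auto simp: S_eta_def)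
  then have "S *v axis None 1 = (\<chi> i. case i of None \<Rightarrow> 1 | Some k \<Rightarrow> b $ k)"
    by (simp add: matrix_vector_mult_basis column_def bordered_def vec_eq_iff split: option.split)
  with S show "S \<in> ?R" by simp
next
  fix S assume "S \<in> ?R"
  then have S: "S \<in> spd" and col: "\<And>i. S $ i $ None = (case i of None \<Rightarrow> 1 | Some k \<Rightarrow> b $ k)"
    by (auto simp: matrix_vector_mult_basis column_def vec_eq_iff)
  let ?A = "\<chi> k l. S $ Some k $ Some l"
  have "S $ None $ Some l = S $ Some l $ None" for l
    using S by (auto simp: spd_def symmetric_matrices_def transpose_def vec_eq_iff)
  then have "S = bordered ?A b 1"
    using col by (auto simp: vec_eq_iff bordered_def split: option.split)
  then show "S \<in> S_eta b"
    using S spd_principal_submatrix[OF S] by (auto simp: S_eta_def)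
qed

theorem theorem6p5:
  fixes \<eta>0 :: "real ^ 'r"
  shows "totally_geodesic_submanifold (S_eta \<eta>0)"
  by (simp only: S_eta_eq_slice totally_geodesic_spd_slice)

end
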